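(* Let $G$ be a countable group with abelian rank $r(G)$. (1) Suppose $r(G)<\infty$. Then $2^{r(G)}$ is a lower bound on the constant associated with a Tempel'man sequence in $G$; that is, if $\{F_n\}$ is a Tempel'man sequence in $G$ and $C$ is a constant such that $|F_n^{-1}F_n|\le C|F_n|$ for every $n$, then $C\ge 2^{r(G)}$. If in addition $G$ is abelian, then there exists in $G$ a Tempel'man sequence with constant $2^{r(G)}$, i.e. a Tempel'man sequence $\{F_n\}$ with $|F_n^{-1}F_n|\le 2^{r(G)}|F_n|$ for every $n$. (2) If $r(G)=\infty$, then $G$ has no Tempel'man sequences.
   Context: For subsets $A,B$ of a group $G$, write $AB=\{ab : a\in A,\ b\in B\}$ and $A^{-1}=\{a^{-1}: a\in A\}$; $|A|$ is the cardinality of $A$. A Følner sequence in a countable group $G$ is a sequence $\{F_n\}_{n\ge 1}$ of finite non-empty subsets of $G$ such that $\frac{1}{|F_n|}|gF_n\cap F_n|\to 1$ as $n\to\infty$ for every $g\in G$. A Tempel'man sequence in $G$ is a Følner sequence $\{F_n\}$ in $G$ that is increasing ($F_n\subseteq F_{n+1}$ for all $n$) and for which there is a constant $C$ such that $|F_n^{-1}F_n|\le C|F_n|$ for every $n$; such a $C$ is called a constant associated with the sequence. The abelian rank of $G$ is $r(G)=\sup\{n : G \text{ contains a subgroup isomorphic to } \mathbb{Z}^n\}\in\{0,1,2,\dots\}\cup\{\infty\}$. *)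

theory Defs
  imports "HOL-Analysis.Analysis" "HOL-Algebra.Algebra"
begin

text \<open>Sequences are indexed by all natural numbers, so the first set is \<open>F 0\<close>.\<close>

definition folner_sequence :: "('a, 'b) monoid_scheme \<Rightarrow> (nat \<Rightarrow> 'a set) \<Rightarrow> bool" where
  "folner_sequence G F \<longleftrightarrow>
     (\<forall>n. F n \<subseteq> carrier G \<and> finite (F n) \<and> F n \<noteq> {}) \<and>
     (\<forall>g\<in>carrier G.
        (\<lambda>n. real (card ((g <#\<^bsub>G\<^esub> F n) \<inter> F n)) / real (card (F n))) \<longlonglongrightarrow> 1)"

definition tempelman_constant ::
    "('a, 'b) monoid_scheme \<Rightarrow> (nat \<Rightarrow> 'a set) \<Rightarrow> real \<Rightarrow> bool" where
  "tempelman_constant G F C \<longleftrightarrow>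
     (\<forall>n. real (card ((set_inv\<^bsub>G\<^esub> (F n)) <#>\<^bsub>G\<^esub> F n)) \<le> C * real (card (F n)))"

definition tempelman_sequence :: "('a, 'b) monoid_scheme \<Rightarrow> (nat \<Rightarrow> 'a set) \<Rightarrow> bool" where
  "tempelman_sequence G F \<longleftrightarrow>
     folner_sequence G F \<and> (\<forall>n. F n \<subseteq> F (Suc n)) \<and> (\<exists>C. tempelman_constant G F C)"

definition abelian_rank :: "('a, 'b) monoid_scheme \<Rightarrow> enat" where
  "abelian_rank G =
     Sup {enat n | n. \<exists>H. subgroup H G \<and>
                          G\<lparr>carrier := H\<rparr> \<cong> product_group {..<n} (\<lambda>_. integer_group)}"

end

theory Submission
  imports Defs "HOL-Library.Function_Algebras"
begin

text \<open>
Write \<open>C\<close> for a constant of a Tempel'man sequence.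

\<^emph>\<open>Lower bound.\<close> Let \<open>\<int>\<^sup>n\<close> embed in \<open>G\<close> and let \<open>Q\<close> be the image of the cube \<open>{0, 1}\<^sup>n\<close>. In \<open>\<int>\<^sup>n\<close> a
discrete Brunn--Minkowski inequality holds: adding the cube to \<open>A + B\<close> gives at least
\<open>2\<^sup>n sqrt (\<bar>A\<bar> \<bar>B\<bar>)\<close> points (\<open>discrete_brunn_minkowski\<close>). Applied along the right cosets of \<open>\<int>\<^sup>n\<close>, always with
the largest coset section of \<open>F\<close> as one of the two sets, it shows that for every finite \<open>F\<close> the products
\<open>f\<^sup>-\<^sup>1 q f'\<close> with \<open>f, f' \<in> F\<close> and \<open>q \<in> Q\<close> number at least \<open>2\<^sup>n \<bar>F\<bar>\<close> (\<open>card_diff_cube_ge\<close>). A Folner set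
is almost invariant under the finite set \<open>Q\<close>, so \<open>Q\<close> can be dropped at the cost of a factor tending to
\<open>1\<close>, and \<open>C \<ge> 2\<^sup>n\<close> (\<open>tempelman_constant_ge\<close>). Every finite \<open>n \<le> r(G)\<close> is the rank of an embedded lattice,
which gives \<open>C \<ge> 2\<^sup>r\<close> for finite rank and a contradiction for infinite rank.

\<^emph>\<open>Construction.\<close> Let \<open>G\<close> be abelian of rank \<open>r\<close> and \<open>E \<cong> \<int>\<^sup>r\<close> a subgroup. By maximality of the rank, \<open>G\<close>
is torsion modulo \<open>E\<close>, so every finite subset lies in a subgroup \<open>D\<close> in which \<open>E\<close> has finite index, and
\<open>D\<close> has rational coordinates with respect to \<open>E\<close>. The set \<open>F\<close> of elements of \<open>D\<close> with all coordinates in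
\<open>[-M, M)\<close> is a union of \<open>(2 M)\<^sup>r\<close> translates of the finite set of elements with coordinates in \<open>[0, 1)\<close>.
Differences have coordinates in \<open>(-2 M, 2 M)\<close>, hence lie in a half-open box of exactly \<open>2\<^sup>r \<bar>F\<bar>\<close>
elements (\<open>card_box_diff\<close>), and for large \<open>M\<close> the set \<open>F\<close> is as invariant as required
(\<open>ex_almost_invariant_box\<close>). Choosing such sets one after another, along an enumeration of \<open>G\<close>, yields the
sequence.
\<close>

section \<open>Integer lattice boxes\<close>

text \<open>\<open>\<int>\<^sup>n\<close> is modelled by finitely supported sequences of a single type, so that \<open>\<int>\<^sup>n\<close> is
contained in \<open>\<int>\<^sup>n\<^sup>+\<^sup>1\<close> and induction on \<open>n\<close> needs no change of type.\<close>

definition int_lattice :: "nat \<Rightarrow> (nat \<Rightarrow> int) set" where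
  "int_lattice n = {z. \<forall>k\<ge>n. z k = 0}"

definition int_box :: "nat \<Rightarrow> int \<Rightarrow> int \<Rightarrow> (nat \<Rightarrow> int) set" where
  "int_box n a b = {z \<in> int_lattice n. \<forall>k<n. a \<le> z k \<and> z k < b}"

lemma int_box_bij: "bij_betw (\<lambda>z. restrict z {..<n}) (int_box n a b) ({..<n} \<rightarrow>\<^sub>E {a..<b})"
proof (rule bij_betwI[where g = "\<lambda>x k. if k < n then x k else 0"])
  show "(\<lambda>z. restrict z {..<n}) \<in> int_box n a b \<rightarrow> {..<n} \<rightarrow>\<^sub>E {a..<b}"
    by (auto simp: int_box_def)
  show "(\<lambda>x k. if k < n then x k else 0) \<in> ({..<n} \<rightarrow>\<^sub>E {a..<b}) \<rightarrow> int_box n a b"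
    by (force simp: int_box_def int_lattice_def PiE_iff)
qed (auto simp: int_box_def int_lattice_def PiE_iff extensional_def fun_eq_iff)

lemma finite_int_box: "finite (int_box n a b)"
  using bij_betw_finite[OF int_box_bij[of n a b]] by (simp add: finite_PiE)

lemma card_int_box: "card (int_box n a b) = nat (b - a) ^ n"
  using bij_betw_same_card[OF int_box_bij[of n a b]] by (simp add: card_PiE)

section \<open>A discrete Brunn--Minkowski inequality\<close>

text \<open>Inside \<open>S + T + {0, 1}\<close> there are disjoint copies of \<open>S\<close> and \<open>T\<close>: no point of the
translate \<open>S + min T\<close> exceeds \<open>max S + min T\<close>, while \<open>max S + T + 1\<close> lies strictly to its right.\<close>

lemma card_int_sumset_with_shift:
  fixes S T U :: "int set"
  assumes "finite S" "S \<noteq> {}" "finite T" "T \<noteq> {}" "finite U"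
    and "\<And>x y. x \<in> S \<Longrightarrow> y \<in> T \<Longrightarrow> x + y \<in> U \<and> x + y + 1 \<in> U"
  shows "card S + card T \<le> card U"
proof -
  let ?L = "(\<lambda>x. x + Min T) ` S" and ?R = "(\<lambda>y. Max S + y + 1) ` T"
  have "?L \<inter> ?R = {}"
  proof -
    have "x + Min T < Max S + y + 1" if "x \<in> S" "y \<in> T" for x y
      using Max_ge[OF assms(1) that(1)] Min_le[OF assms(3) that(2)] by linarith
    thus ?thesis by fastforce
  qed
  hence "card (?L \<union> ?R) = card S + card T"
    using assms by (subst card_Un_disjoint) (auto simp: card_image inj_on_def)
  moreover have "?L \<union> ?R \<subseteq> U"
    using assms(6)[OF _ Min_in[OF assms(3,4)]] assms(6)[OF Max_in[OF assms(1,2)]] by auto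
  ultimately show ?thesis
    using card_mono[OF assms(5)] by metis
qed

text \<open>Writing a sum as an integral of level set sizes turns the next inequality between sums into
the preceding inequality between cardinalities.\<close>

lemma layer_cake_sum:
  fixes f :: "'i \<Rightarrow> real"
  assumes "finite I" "\<And>i. i \<in> I \<Longrightarrow> 0 \<le> f i \<and> f i \<le> 1"
  shows "((\<lambda>t. real (card {i\<in>I. t \<le> f i})) has_integral (\<Sum>i\<in>I. f i)) {0..1}"
proof -
  have "((\<lambda>t. if t \<le> f i then 1 else 0) has_integral f i) {0..1}" if "i \<in> I" for i
  proof -
    have "((\<lambda>t. 1::real) has_integral f i) {0..f i}"
      using has_integral_const_real[of "1::real" 0 "f i"] assms(2)[OF that] by simp
    hence "((\<lambda>t. if t \<in> {0..f i} then 1 else 0) has_integral f i) {0..1}"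
      using assms(2)[OF that] by (subst has_integral_restrict) auto
    thus ?thesis
      by (rule has_integral_eq[rotated]) auto
  qed
  hence "((\<lambda>t. \<Sum>i\<in>I. if t \<le> f i then 1 else 0) has_integral (\<Sum>i\<in>I. f i)) {0..1}"
    using assms(1) by (intro has_integral_sum) auto
  moreover have "(\<Sum>i\<in>I. if t \<le> f i then 1 else 0) = real (card {i\<in>I. t \<le> f i})" for t
    using assms(1) by (simp add: sum.If_cases Int_def)
  ultimately show ?thesis by simp
qed

text \<open>A one-dimensional inequality of Prekopa--Leindler type. The hypothesis says that every level
set of \<open>h\<close> contains the sum of those of \<open>f\<close> and \<open>g\<close> and \<open>{0, 1}\<close>. Normalising both maxima to \<open>1\<close>
makes the level sets of \<open>f\<close> and \<open>g\<close> nonempty at exactly the same heights, which the level set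
inequality requires.\<close>

lemma sum_le_of_sup_convolution:
  fixes f g h :: "int \<Rightarrow> real"
  assumes fin: "finite I" "finite J" "finite K"
    and f: "\<And>i. i \<in> I \<Longrightarrow> 0 \<le> f i \<and> f i \<le> 1" "\<exists>i\<in>I. f i = 1"
    and g: "\<And>j. j \<in> J \<Longrightarrow> 0 \<le> g j \<and> g j \<le> 1" "\<exists>j\<in>J. g j = 1"
    and h0: "\<And>k. k \<in> K \<Longrightarrow> 0 \<le> h k"
    and h: "\<And>i j k. i \<in> I \<Longrightarrow> j \<in> J \<Longrightarrow> k \<in> {i + j, i + j + 1} \<Longrightarrow> k \<in> K \<and> min (f i) (g j) \<le> h k"
  shows "(\<Sum>i\<in>I. f i) + (\<Sum>j\<in>J. g j) \<le> (\<Sum>k\<in>K. h k)"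
proof -
  \<comment> \<open>Truncation at \<open>1\<close> keeps all level sets that matter and confines the integral to \<open>[0, 1]\<close>.\<close>
  define h' where "h' k = min 1 (h k)" for k
  have "((\<lambda>t. real (card {i\<in>I. t \<le> f i}) + real (card {j\<in>J. t \<le> g j}))
          has_integral (\<Sum>i\<in>I. f i) + (\<Sum>j\<in>J. g j)) {0..1}"
    by (intro has_integral_add layer_cake_sum fin f g)
  moreover have "((\<lambda>t. real (card {k\<in>K. t \<le> h' k})) has_integral (\<Sum>k\<in>K. h' k)) {0..1}"
    by (intro layer_cake_sum fin) (auto simp: h'_def h0)
  moreover have "real (card {i\<in>I. t \<le> f i}) + real (card {j\<in>J. t \<le> g j}) \<le> real (card {k\<in>K. t \<le> h' k})"
    if t: "t \<in> {0..1}" for t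
  proof -
    have "card {i\<in>I. t \<le> f i} + card {j\<in>J. t \<le> g j} \<le> card {k\<in>K. t \<le> h' k}"
    proof (rule card_int_sumset_with_shift)
      show "{i\<in>I. t \<le> f i} \<noteq> {}" "{j\<in>J. t \<le> g j} \<noteq> {}"
        using f(2) g(2) t by auto
      fix x y assume "x \<in> {i\<in>I. t \<le> f i}" "y \<in> {j\<in>J. t \<le> g j}"
      thus "x + y \<in> {k\<in>K. t \<le> h' k} \<and> x + y + 1 \<in> {k\<in>K. t \<le> h' k}"
        using h[of x y "x + y"] h[of x y "x + y + 1"] t by (auto simp: h'_def)
    qed (use fin in auto)
    thus ?thesis by linarith
  qed
  ultimately have "(\<Sum>i\<in>I. f i) + (\<Sum>j\<in>J. g j) \<le> (\<Sum>k\<in>K. h' k)"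
    by (rule has_integral_le)
  also have "\<dots> \<le> (\<Sum>k\<in>K. h k)"
    by (intro sum_mono) (simp add: h'_def)
  finally show ?thesis .
qed

definition cube_sumset :: "nat \<Rightarrow> (nat \<Rightarrow> int) set \<Rightarrow> (nat \<Rightarrow> int) set \<Rightarrow> (nat \<Rightarrow> int) set" where
  "cube_sumset n A B = {a + b + q |a b q. a \<in> A \<and> b \<in> B \<and> q \<in> int_box n 0 2}"

lemma finite_cube_sumset:
  assumes "finite A" "finite B" shows "finite (cube_sumset n A B)"
proof -
  have "cube_sumset n A B = (\<lambda>(a, b, q). a + b + q) ` (A \<times> B \<times> int_box n 0 2)"
    by (auto simp: cube_sumset_def image_iff) blast
  thus ?thesis using assms finite_int_box by simp
qed

lemma card_eq_sum_fibres:
  assumes "finite A"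
  shows "card A = (\<Sum>i\<in>\<phi> ` A. card {a\<in>A. \<phi> a = i})"
  using sum.group[of A "\<phi> ` A" \<phi> "\<lambda>_. 1::nat"] assms by simp

text \<open>The unit cube \<open>{0, 1}\<^sup>n\<close> plays the part of the volume of lattice cells. The multiplicative form
with \<open>sqrt (\<bar>A\<bar> \<bar>B\<bar>)\<close> is the one that passes through an induction on the dimension: slices of \<open>A\<close>
and \<open>B\<close> at last coordinates \<open>i\<close> and \<open>j\<close> produce, by induction, large slices of the sumset at
\<open>i + j\<close> and \<open>i + j + 1\<close>, and the one-dimensional inequality is applied to the slice sizes of
\<open>A\<close> and of \<open>B\<close>, divided by their maxima. The arithmetic-geometric mean inequality then removes the two maxima.
Requiring only that the coordinates from \<open>n\<close> on are constant on \<open>A\<close> and on \<open>B\<close>, rather than zero,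
makes the induction hypothesis applicable to slices as they stand.\<close>

lemma discrete_brunn_minkowski:
  assumes "finite A" "A \<noteq> {}" "finite B" "B \<noteq> {}"
    and "\<And>a a' k. a \<in> A \<Longrightarrow> a' \<in> A \<Longrightarrow> k \<ge> n \<Longrightarrow> a k = a' k"
    and "\<And>b b' k. b \<in> B \<Longrightarrow> b' \<in> B \<Longrightarrow> k \<ge> n \<Longrightarrow> b k = b' k"
  shows "2 ^ n * sqrt (real (card A) * real (card B)) \<le> real (card (cube_sumset n A B))"
  using assms
proof (induction n arbitrary: A B)
  case 0
  obtain a b where "a \<in> A" "b \<in> B" using 0 by blast
  hence AB: "A = {a}" "B = {b}" using 0(5,6) by (auto simp: fun_eq_iff)
  have "a + b + 0 \<in> cube_sumset 0 A B"
    unfolding cube_sumset_def using AB by (fastforce simp: int_box_def int_lattice_def)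
  moreover have "finite (cube_sumset 0 A B)"
    using 0 by (intro finite_cube_sumset)
  ultimately have "0 < card (cube_sumset 0 A B)"
    by (auto simp: card_gt_0_iff)
  thus ?case using AB by simp
next
  case (Suc n)
  define I where "I = (\<lambda>a. a n) ` A"
  define J where "J = (\<lambda>b. b n) ` B"
  define T where "T = cube_sumset (Suc n) A B"
  define K where "K = (\<lambda>t. t n) ` T"
  define As where "As i = {a\<in>A. a n = i}" for i
  define Bs where "Bs j = {b\<in>B. b n = j}" for j
  define Ts where "Ts k = {t\<in>T. t n = k}" for k
  define \<alpha> where "\<alpha> = Max ((\<lambda>i. card (As i)) ` I)"
  define \<beta> where "\<beta> = Max ((\<lambda>j. card (Bs j)) ` J)"
  have finT: "finite T" unfolding T_def using Suc.prems by (intro finite_cube_sumset)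
  have fin: "finite I" "finite J" "finite K" "I \<noteq> {}" "J \<noteq> {}"
    using Suc.prems finT by (auto simp: I_def J_def K_def)
  have finS: "finite (As i)" "finite (Bs i)" "finite (Ts i)" for i
    using Suc.prems finT by (auto simp: As_def Bs_def Ts_def)
  have ne: "As i \<noteq> {}" if "i \<in> I" for i using that by (auto simp: As_def I_def)
  have ne': "Bs i \<noteq> {}" if "i \<in> J" for i using that by (auto simp: Bs_def J_def)
  have \<alpha>_ge: "card (As i) \<le> \<alpha>" if "i \<in> I" for i
    unfolding \<alpha>_def using fin that by (intro Max_ge) auto
  have \<beta>_ge: "card (Bs i) \<le> \<beta>" if "i \<in> J" for i
    unfolding \<beta>_def using fin that by (intro Max_ge) auto
  have "\<alpha> \<in> (\<lambda>i. card (As i)) ` I" "\<beta> \<in> (\<lambda>j. card (Bs j)) ` J"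
    unfolding \<alpha>_def \<beta>_def using fin by (intro Max_in; simp)+
  then obtain i0 j0 where i0: "i0 \<in> I" "\<alpha> = card (As i0)" and j0: "j0 \<in> J" "\<beta> = card (Bs j0)"
    by auto
  have pos: "0 < \<alpha>" "0 < \<beta>"
    using i0 j0 ne ne' finS by (auto simp: card_gt_0_iff)
  have slice: "k \<in> K \<and> 2 ^ n * sqrt (real (card (As i)) * real (card (Bs j))) \<le> real (card (Ts k))"
    if i: "i \<in> I" and j: "j \<in> J" and k: "k \<in> {i + j, i + j + 1}" for i j k
  proof -
    define S where "S = cube_sumset n (As i) (Bs j)"
    \<comment> \<open>All of \<open>S\<close> has last coordinate \<open>i + j\<close>; resetting it to \<open>k\<close> is a translation by \<open>0\<close> or by the
        last unit vector, which the larger cube allows.\<close>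
    define \<sigma> where "\<sigma> x = x(n := k)" for x :: "nat \<Rightarrow> int"
    have IH: "2 ^ n * sqrt (real (card (As i)) * real (card (Bs j))) \<le> real (card S)"
      unfolding S_def
    proof (rule Suc.IH)
      show "a k = a' k" if "a \<in> As i" "a' \<in> As i" "n \<le> k" for a a' k
        using that Suc.prems(5)[of a a' k] by (cases "k = n") (auto simp: As_def)
      show "a k = a' k" if "a \<in> Bs j" "a' \<in> Bs j" "n \<le> k" for a a' k
        using that Suc.prems(6)[of a a' k] by (cases "k = n") (auto simp: Bs_def)
    qed (use finS ne ne' i j in auto)
    have Sn: "s n = i + j" if "s \<in> S" for s
      using that by (auto simp: S_def cube_sumset_def As_def Bs_def int_box_def int_lattice_def)
    have inj: "inj_on \<sigma> S"
      by (rule inj_onI) (metis Sn \<sigma>_def fun_upd_triv fun_upd_upd)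
    have sub: "\<sigma> ` S \<subseteq> Ts k"
    proof (rule image_subsetI)
      fix s assume "s \<in> S"
      then obtain a b q where s: "s = a + b + q" "a \<in> As i" "b \<in> Bs j" "q \<in> int_box n 0 2"
        by (auto simp: S_def cube_sumset_def)
      let ?q = "q(n := k - (i + j))"
      have "?q \<in> int_box (Suc n) 0 2"
        using s(4) k by (auto simp: int_box_def int_lattice_def less_Suc_eq)
      moreover have "\<sigma> s = a + b + ?q"
        using s by (auto simp: \<sigma>_def fun_eq_iff As_def Bs_def)
      ultimately show "\<sigma> s \<in> Ts k"
        using s by (auto simp: Ts_def T_def cube_sumset_def As_def Bs_def \<sigma>_def)
    qed
    have "card S \<le> card (Ts k)"
      using card_inj_on_le[OF inj sub finS(3)] .
    moreover have "S \<noteq> {}"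
    proof -
      have "0 < card (As i)" "0 < card (Bs j)" using ne ne' i j finS by (auto simp: card_gt_0_iff)
      hence "0 < real (card S)" by (intro less_le_trans[OF _ IH]) simp
      thus ?thesis by auto
    qed
    ultimately show ?thesis using IH sub by (force simp: K_def Ts_def)
  qed
  define c where "c = 2 ^ n * sqrt (real \<alpha> * real \<beta>)"
  have c: "0 < c" using pos by (simp add: c_def)
  have "(\<Sum>i\<in>I. card (As i) / \<alpha>) + (\<Sum>j\<in>J. card (Bs j) / \<beta>) \<le> (\<Sum>k\<in>K. card (Ts k) / c)"
  proof (rule sum_le_of_sup_convolution)
    fix i j k assume ijk: "i \<in> I" "j \<in> J" "k \<in> {i + j, i + j + 1}"
    let ?a = "card (As i) / real \<alpha>" and ?b = "card (Bs j) / real \<beta>"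
    have "min ?a ?b = sqrt (min ?a ?b * min ?a ?b)" by simp
    also have "\<dots> \<le> sqrt (?a * ?b)"
      by (intro real_sqrt_le_mono mult_mono) auto
    also have "\<dots> = 2 ^ n * sqrt (real (card (As i)) * real (card (Bs j))) / c"
      by (simp add: c_def real_sqrt_mult real_sqrt_divide)
    also have "\<dots> \<le> card (Ts k) / c"
      using slice[OF ijk] c by (intro divide_right_mono) auto
    finally show "k \<in> K \<and> min ?a ?b \<le> card (Ts k) / c"
      using slice[OF ijk] by simp
  next
    show "\<exists>i\<in>I. card (As i) / real \<alpha> = 1"
      using i0 pos by (intro bexI[of _ i0]) simp_all
    show "\<exists>j\<in>J. card (Bs j) / real \<beta> = 1"
      using j0 pos by (intro bexI[of _ j0]) simp_all
  qed (use fin pos \<alpha>_ge \<beta>_ge c in \<open>auto simp: divide_le_eq_1\<close>)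
  also have "(\<Sum>i\<in>I. card (As i) / \<alpha>) = card A / \<alpha>"
    using card_eq_sum_fibres[of A "\<lambda>a. a n"] Suc.prems
    by (simp add: I_def As_def sum_divide_distrib)
  also have "(\<Sum>j\<in>J. card (Bs j) / \<beta>) = card B / \<beta>"
    using card_eq_sum_fibres[of B "\<lambda>a. a n"] Suc.prems
    by (simp add: J_def Bs_def sum_divide_distrib)
  also have "(\<Sum>k\<in>K. card (Ts k) / c) = card T / c"
    using card_eq_sum_fibres[of T "\<lambda>a. a n"] finT
    by (simp add: K_def Ts_def sum_divide_distrib)
  finally have *: "card A / \<alpha> + card B / \<beta> \<le> card T / c" .
  have "2 * sqrt ((card A / \<alpha>) * (card B / \<beta>)) \<le> card A / \<alpha> + card B / \<beta>"
    using arith_geo_mean_sqrt[of "card A / \<alpha>" "card B / \<beta>"] by simp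
  also note *
  finally have "c * (2 * sqrt ((card A / \<alpha>) * (card B / \<beta>))) \<le> card T"
    using c by (simp only: pos_le_divide_eq mult.commute[of c])
  moreover have "c * (2 * sqrt ((card A / \<alpha>) * (card B / \<beta>))) = 2 ^ Suc n * sqrt (real (card A) * real (card B))"
    using pos by (simp add: c_def real_sqrt_mult real_sqrt_divide)
  ultimately show ?case by (simp add: T_def)
qed

section \<open>Copies of the integer lattice in a group\<close>

lemma int_lattice_closed:
  "0 \<in> int_lattice n"
  "z \<in> int_lattice n \<Longrightarrow> w \<in> int_lattice n \<Longrightarrow> z + w \<in> int_lattice n"
  "z \<in> int_lattice n \<Longrightarrow> w \<in> int_lattice n \<Longrightarrow> z - w \<in> int_lattice n"
  "z \<in> int_lattice n \<Longrightarrow> - z \<in> int_lattice n"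
  by (auto simp: int_lattice_def)

lemma int_box_subset: "int_box n a b \<subseteq> int_lattice n"
  by (auto simp: int_box_def)

locale embedded_lattice = group G for G :: "('a, 'b) monoid_scheme" (structure) +
  fixes n :: nat and \<psi> :: "(nat \<Rightarrow> int) \<Rightarrow> 'a"
  assumes emb_closed: "z \<in> int_lattice n \<Longrightarrow> \<psi> z \<in> carrier G"
    and emb_add: "z \<in> int_lattice n \<Longrightarrow> w \<in> int_lattice n \<Longrightarrow> \<psi> (z + w) = \<psi> z \<otimes> \<psi> w"
    and emb_inj: "inj_on \<psi> (int_lattice n)"
begin

abbreviation L where "L \<equiv> \<psi> ` int_lattice n"

lemma emb_zero: "\<psi> 0 = \<one>"
  using emb_add[of 0 0] emb_closed[of 0] int_lattice_closed(1) by simp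

lemma emb_minus: "z \<in> int_lattice n \<Longrightarrow> \<psi> (- z) = inv (\<psi> z)"
  using emb_add[of "- z" z] emb_zero emb_closed int_lattice_closed
  by (intro inv_equality[symmetric]) auto

lemma subgroup_L: "subgroup L G"
proof (rule subgroupI)
  show "L \<noteq> {}" using int_lattice_closed(1) by blast
  show "inv a \<in> L" if "a \<in> L" for a
    using that by (auto simp: emb_minus[symmetric] int_lattice_closed)
  show "a \<otimes> b \<in> L" if "a \<in> L" "b \<in> L" for a b
    using that by (auto simp: emb_add[symmetric] int_lattice_closed)
qed (use emb_closed in auto)

end

lemma (in group) embedded_latticeI:
  assumes "\<And>z. z \<in> int_lattice n \<Longrightarrow> \<psi> z \<in> carrier G"
    and add: "\<And>z w. z \<in> int_lattice n \<Longrightarrow> w \<in> int_lattice n \<Longrightarrow> \<psi> (z + w) = \<psi> z \<otimes> \<psi> w"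
    and ker: "\<And>z. z \<in> int_lattice n \<Longrightarrow> \<psi> z = \<one> \<Longrightarrow> z = 0"
  shows "embedded_lattice G n \<psi>"
proof
  show "inj_on \<psi> (int_lattice n)"
  proof (rule inj_onI)
    fix z w assume zw: "z \<in> int_lattice n" "w \<in> int_lattice n" "\<psi> z = \<psi> w"
    have "z - w \<in> int_lattice n" using zw int_lattice_closed by blast
    moreover have "\<psi> (z - w) \<otimes> \<psi> w = \<psi> w"
      using add[OF \<open>z - w \<in> int_lattice n\<close> zw(2)] zw by simp
    ultimately have "z - w = 0"
      using assms(1) zw by (intro ker) auto
    thus "z = w" by simp
  qed
qed (use assms in auto)

text \<open>For \<open>n > 0\<close>, a bound \<open>n \<le> r(G)\<close> only says that some \<open>N \<ge> n\<close> is realised, whether or not the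
supremum is attained; the copy of \<open>\<int>\<^sup>N\<close> is then restricted to its first \<open>n\<close> coordinates.\<close>

lemma (in group) embedded_lattice_iff_le_abelian_rank:
  "(\<exists>\<psi>. embedded_lattice G n \<psi>) \<longleftrightarrow> enat n \<le> abelian_rank G"
proof
  let ?P = "\<lambda>n. product_group {..<n} (\<lambda>_. integer_group)"
  let ?R = "{enat n |n. \<exists>H. subgroup H G \<and> G\<lparr>carrier := H\<rparr> \<cong> ?P n}"
  {
    assume "\<exists>\<psi>. embedded_lattice G n \<psi>"
    then obtain \<psi> where "embedded_lattice G n \<psi>" by blast
    then interpret embedded_lattice G n \<psi> .
    define ext :: "(nat \<Rightarrow> int) \<Rightarrow> nat \<Rightarrow> int" where "ext x = (\<lambda>k. if k < n then x k else 0)" for x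
    have ext_bij: "bij_betw ext (carrier (?P n)) (int_lattice n)"
      by (rule bij_betwI[where g = "\<lambda>z. restrict z {..<n}"])
         (auto simp: ext_def int_lattice_def PiE_iff extensional_def fun_eq_iff)
    have ext_mem: "ext x \<in> int_lattice n" for x
      by (auto simp: ext_def int_lattice_def)
    have "(\<psi> \<circ> ext) \<in> iso (?P n) (G\<lparr>carrier := L\<rparr>)"
    proof (rule isoI)
      show "\<psi> \<circ> ext \<in> hom (?P n) (G\<lparr>carrier := L\<rparr>)"
      proof (rule homI)
        fix x y
        have "ext (x \<otimes>\<^bsub>?P n\<^esub> y) = ext x + ext y"
          by (auto simp: ext_def fun_eq_iff)
        thus "(\<psi> \<circ> ext) (x \<otimes>\<^bsub>?P n\<^esub> y) = (\<psi> \<circ> ext) x \<otimes>\<^bsub>G\<lparr>carrier := L\<rparr>\<^esub> (\<psi> \<circ> ext) y"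
          using emb_add ext_mem by simp
      qed (use ext_mem in auto)
      show "bij_betw (\<psi> \<circ> ext) (carrier (?P n)) (carrier (G\<lparr>carrier := L\<rparr>))"
        using bij_betw_trans[OF ext_bij inj_on_imp_bij_betw[OF emb_inj]] by simp
    qed
    hence "?P n \<cong> G\<lparr>carrier := L\<rparr>" by (rule is_isoI)
    hence "G\<lparr>carrier := L\<rparr> \<cong> ?P n"
      by (rule group.iso_sym[rotated]) simp
    thus "enat n \<le> abelian_rank G"
      unfolding abelian_rank_def using subgroup_L by (intro Sup_upper) blast
  }
  assume n: "enat n \<le> abelian_rank G"
  show "\<exists>\<psi>. embedded_lattice G n \<psi>"
  proof (cases "n = 0")
    case True
    have "embedded_lattice G n (\<lambda>_. \<one>)"
      using True by (intro embedded_latticeI) (auto simp: int_lattice_def fun_eq_iff)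
    thus ?thesis by blast
  next
    case False
    hence "enat (n - 1) < enat n" by simp
    also have "enat n \<le> Sup ?R"
      using n unfolding abelian_rank_def .
    finally obtain N H where "n - 1 < N" and NH: "subgroup H G" "G\<lparr>carrier := H\<rparr> \<cong> ?P N"
      by (auto simp: less_Sup_iff)
    hence N: "n \<le> N" by simp
    have "group (G\<lparr>carrier := H\<rparr>)"
      using NH(1) by (rule subgroup_imp_group)
    hence "?P N \<cong> G\<lparr>carrier := H\<rparr>"
      using NH(2) by (rule group.iso_sym)
    then obtain h where h: "h \<in> iso (?P N) (G\<lparr>carrier := H\<rparr>)"
      by (auto simp: is_iso_def)
    have hom: "h (x \<otimes>\<^bsub>?P N\<^esub> y) = h x \<otimes> h y"
      if "x \<in> carrier (?P N)" "y \<in> carrier (?P N)" for x y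
      using h that by (auto simp: iso_def hom_def)
    have bij: "bij_betw h (carrier (?P N)) H"
      using h by (auto simp: iso_def)
    have mem: "restrict z {..<N} \<in> carrier (?P N)" for z :: "nat \<Rightarrow> int"
      by auto
    have "embedded_lattice G n (\<lambda>z. h (restrict z {..<N}))"
    proof
      fix z w :: "nat \<Rightarrow> int"
      show "h (restrict z {..<N}) \<in> carrier G"
        using bij_betwE[OF bij] mem subgroup.subset[OF NH(1)] by blast
      have "restrict (z + w) {..<N} = restrict z {..<N} \<otimes>\<^bsub>?P N\<^esub> restrict w {..<N}"
        by (auto simp: fun_eq_iff)
      thus "h (restrict (z + w) {..<N}) = h (restrict z {..<N}) \<otimes> h (restrict w {..<N})"
        using hom[OF mem mem, of z w] by simp
    next
      show "inj_on (\<lambda>z. h (restrict z {..<N})) (int_lattice n)"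
      proof (rule inj_onI)
        fix z w assume zw: "z \<in> int_lattice n" "w \<in> int_lattice n"
          "h (restrict z {..<N}) = h (restrict w {..<N})"
        have "restrict z {..<N} = restrict w {..<N}"
          using bij_betw_imp_inj_on[OF bij] zw(3) mem by (meson inj_onD)
        hence "z k = w k" if "k < N" for k
          using that by (metis lessThan_iff restrict_apply')
        moreover have "z k = w k" if "k \<ge> N" for k
          using that zw N by (auto simp: int_lattice_def)
        ultimately show "z = w" by (metis ext not_le)
      qed
    qed
    thus ?thesis by blast
  qed
qed

section \<open>The lower bound\<close>

lemma (in group) card_translate_Int:
  assumes "g \<in> carrier G" "F \<subseteq> carrier G"
  shows "card (l_coset G g F \<inter> F) = card {f\<in>F. g \<otimes> f \<in> F}"
proof -
  have "l_coset G g F \<inter> F = (\<lambda>f. g \<otimes> f) ` {f\<in>F. g \<otimes> f \<in> F}"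
    by (auto simp: l_coset_def)
  moreover have "inj_on (\<lambda>f. g \<otimes> f) {f\<in>F. g \<otimes> f \<in> F}"
    using assms by (intro inj_onI) (metis (no_types, lifting) l_cancel mem_Collect_eq subsetD)
  ultimately show ?thesis by (simp add: card_image)
qed

context embedded_lattice
begin

text \<open>Cut \<open>F\<close> along the right cosets of the lattice and fix \<open>x \<in> F\<close> in a coset that meets \<open>F\<close> in as many
points as possible. Already the part of \<open>F\<close> in the coset of \<open>x\<close>, used as the left factor, suffices:
against the part in the coset of \<open>y\<close> it produces a sumset in \<open>\<int>\<^sup>n\<close> whose size is at least \<open>2\<^sup>n\<close>
times the geometric mean of the two sizes, hence at least \<open>2\<^sup>n\<close> times the smaller one, the part of
\<open>y\<close>. These sumsets lie in distinct cosets, so their sizes add up. The ambient group may be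
non-commutative because the coset on the left is fixed: all the products are then moved back into
right cosets of the lattice by one and the same left translation.\<close>

lemma card_diff_cube_ge:
  assumes F: "finite F" "F \<subseteq> carrier G"
  shows "2 ^ n * card F \<le> card (set_inv F <#> (\<psi> ` int_box n 0 2 <#> F))"
proof (cases "F = {}")
  case False
  let ?V = "int_lattice n" and ?Q = "int_box n 0 2"
  \<comment> \<open>The part of \<open>F\<close> in the coset of \<open>y\<close>, in coordinates centred at \<open>y\<close>.\<close>
  define fib where "fib y = {z\<in>?V. \<psi> z \<otimes> y \<in> F}" for y
  define \<kappa> where "\<kappa> y = L #> y" for y
  have Q: "q \<in> ?V" if "q \<in> ?Q" for q using that int_box_subset by blast
  have inj: "inj_on (\<lambda>z. \<psi> z \<otimes> y) ?V" if "y \<in> carrier G" for y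
    using emb_inj emb_closed that by (auto simp: inj_on_def)
  have fin_fib: "finite (fib y)" if "y \<in> carrier G" for y
  proof (rule inj_on_finite)
    show "inj_on (\<lambda>z. \<psi> z \<otimes> y) (fib y)"
      using inj[OF that] by (rule inj_on_subset) (auto simp: fib_def)
  qed (use F in \<open>auto simp: fib_def\<close>)
  have "Max ((\<lambda>y. card (fib y)) ` F) \<in> (\<lambda>y. card (fib y)) ` F"
    using F False by (intro Max_in) auto
  then obtain x where x: "x \<in> F" "card (fib x) = Max ((\<lambda>y. card (fib y)) ` F)" by auto
  have x_max: "card (fib y) \<le> card (fib x)" if "y \<in> F" for y
    unfolding x(2) using F that by (intro Max_ge) auto
  have fib0: "0 \<in> fib y" if "y \<in> F" for y
    using that F emb_zero int_lattice_closed(1) by (auto simp: fib_def)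
  have \<kappa>: "\<kappa> (\<psi> z \<otimes> y) = \<kappa> y" if "z \<in> ?V" "y \<in> carrier G" for z y
    unfolding \<kappa>_def using that subgroup_L
    by (intro repr_independence[symmetric]) (auto simp: r_coset_def)
  have \<kappa>_eqD: "\<exists>z\<in>?V. f = \<psi> z \<otimes> y" if "\<kappa> f = \<kappa> y" "f \<in> carrier G" for f y
    using rcos_self[OF that(2) subgroup_L] that(1) by (auto simp: \<kappa>_def r_coset_def)
  \<comment> \<open>Multiplying by \<open>x\<close> on the left moves the products with left factor in the coset of \<open>x\<close>
      back into the right cosets that meet \<open>F\<close>.\<close>
  define W where "W = {\<psi> (q - a) \<otimes> y |q a y. q \<in> ?Q \<and> a \<in> fib x \<and> y \<in> F}"
  define T where "T = set_inv F <#> (\<psi> ` ?Q <#> F)"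
  have "T = (\<lambda>(f, q, y). inv f \<otimes> (\<psi> q \<otimes> y)) ` (F \<times> ?Q \<times> F)"
    by (force simp: T_def SET_INV_def set_mult_def)
  hence finT: "finite T" using F finite_int_box by simp
  have W_carrier: "W \<subseteq> carrier G"
    using Q F emb_closed int_lattice_closed by (auto simp: W_def fib_def)
  have "(\<lambda>w. inv x \<otimes> w) ` W \<subseteq> T"
  proof (rule image_subsetI)
    fix w assume "w \<in> W"
    then obtain q a y where w: "w = \<psi> (q - a) \<otimes> y" "q \<in> ?Q" "a \<in> fib x" "y \<in> F"
      by (auto simp: W_def)
    have a: "a \<in> ?V" "\<psi> a \<otimes> x \<in> F" using w by (auto simp: fib_def)
    have "\<psi> (q - a) = \<psi> (- a) \<otimes> \<psi> q"
      using emb_add[of "- a" q] a Q[OF w(2)] int_lattice_closed by simp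
    hence "inv x \<otimes> w = inv (\<psi> a \<otimes> x) \<otimes> (\<psi> q \<otimes> y)"
      using w a x F emb_closed Q[OF w(2)] emb_minus
      by (simp add: inv_mult_group m_assoc subset_iff)
    thus "inv x \<otimes> w \<in> T"
      using w a by (auto simp: T_def SET_INV_def set_mult_def)
  qed
  moreover have inj_x: "inj_on (\<lambda>w. inv x \<otimes> w) W"
    using W_carrier x F by (intro inj_onI) (metis inv_closed l_cancel subsetD)
  ultimately have W_le: "card W \<le> card T" and finW: "finite W"
    using finT by (auto intro: card_inj_on_le inj_on_finite)
  have coset: "2 ^ n * card {f\<in>F. \<kappa> f = \<kappa> y} \<le> card {w\<in>W. \<kappa> w = \<kappa> y}" if y: "y \<in> F" for y
  proof -
    have yc: "y \<in> carrier G" using y F by auto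
    define A where "A = uminus ` fib x"
    have cA: "card A = card (fib x)" by (simp add: A_def card_image)
    have AV: "A \<subseteq> ?V" using int_lattice_closed by (auto simp: A_def fib_def)
    have SV: "cube_sumset n A (fib y) \<subseteq> ?V"
      using AV Q int_lattice_closed(2) by (auto simp: cube_sumset_def fib_def)
    have "{f\<in>F. \<kappa> f = \<kappa> y} \<subseteq> (\<lambda>z. \<psi> z \<otimes> y) ` fib y"
    proof
      fix f assume f: "f \<in> {f\<in>F. \<kappa> f = \<kappa> y}"
      then obtain z where "z \<in> ?V" "f = \<psi> z \<otimes> y" using \<kappa>_eqD[of f y] F by auto
      thus "f \<in> (\<lambda>z. \<psi> z \<otimes> y) ` fib y" using f by (auto simp: fib_def)
    qed
    hence 1: "card {f\<in>F. \<kappa> f = \<kappa> y} \<le> card (fib y)"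
      using fin_fib[OF yc] by (rule surj_card_le[rotated])
    have "real (card (fib y)) = sqrt (real (card (fib y)) * real (card (fib y)))" by simp
    also have "\<dots> \<le> sqrt (real (card A) * real (card (fib y)))"
      using x_max[OF y] cA by (intro real_sqrt_le_mono mult_right_mono) auto
    finally have "2 ^ n * real (card (fib y)) \<le> 2 ^ n * sqrt (real (card A) * real (card (fib y)))"
      by simp
    also have "\<dots> \<le> real (card (cube_sumset n A (fib y)))"
    proof (rule discrete_brunn_minkowski)
      show "finite A" "A \<noteq> {}" "finite (fib y)" "fib y \<noteq> {}"
        using fin_fib[OF yc] fin_fib[of x] fib0 x F y by (auto simp: A_def)
    next
      have "z k = 0" if "z \<in> ?V" "n \<le> k" for z k using that by (simp add: int_lattice_def)
      moreover have "fib y \<subseteq> ?V" by (auto simp: fib_def)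
      ultimately have vanish: "z k = 0" if "z \<in> A \<union> fib y" "n \<le> k" for z k
        using that AV by blast
      show "a k = a' k" if "a \<in> A" "a' \<in> A" "n \<le> k" for a a' k
        using that by (simp add: vanish)
      show "b k = b' k" if "b \<in> fib y" "b' \<in> fib y" "n \<le> k" for b b' k
        using that by (simp add: vanish)
    qed
    finally have 2: "2 ^ n * card (fib y) \<le> card (cube_sumset n A (fib y))"
      by (metis of_nat_le_iff of_nat_mult of_nat_numeral of_nat_power)
    have 3: "card (cube_sumset n A (fib y)) \<le> card {w\<in>W. \<kappa> w = \<kappa> y}"
    proof (rule card_inj_on_le)
      show "inj_on (\<lambda>z. \<psi> z \<otimes> y) (cube_sumset n A (fib y))"
        using inj[OF yc] SV by (rule inj_on_subset)
      show "(\<lambda>z. \<psi> z \<otimes> y) ` cube_sumset n A (fib y) \<subseteq> {w\<in>W. \<kappa> w = \<kappa> y}"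
      proof (rule image_subsetI)
        fix z assume z: "z \<in> cube_sumset n A (fib y)"
        then obtain a b q where abq: "z = - a + b + q" "a \<in> fib x" "b \<in> fib y" "q \<in> ?Q"
          by (auto simp: cube_sumset_def A_def)
        have V: "q - a \<in> ?V" "b \<in> ?V"
          using abq Q int_lattice_closed by (auto simp: fib_def)
        have "\<psi> z = \<psi> (q - a) \<otimes> \<psi> b"
          using emb_add[OF V] by (simp add: abq(1) algebra_simps)
        hence "\<psi> z \<otimes> y = \<psi> (q - a) \<otimes> (\<psi> b \<otimes> y)"
          using V emb_closed yc by (simp add: m_assoc)
        hence "\<psi> z \<otimes> y \<in> W"
          unfolding W_def using abq by (auto simp: fib_def)
        thus "\<psi> z \<otimes> y \<in> {w\<in>W. \<kappa> w = \<kappa> y}"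
          using \<kappa> SV z yc by auto
      qed
    qed (use finW in auto)
    show ?thesis
      using mult_le_mono2[OF 1, of "2 ^ n"] 2 3 by linarith
  qed
  have "\<kappa> ` W \<subseteq> \<kappa> ` F"
  proof (rule image_subsetI)
    fix w assume "w \<in> W"
    then obtain q a y where w: "w = \<psi> (q - a) \<otimes> y" "q \<in> ?Q" "a \<in> fib x" "y \<in> F"
      by (auto simp: W_def)
    have "q - a \<in> ?V" using w Q int_lattice_closed by (auto simp: fib_def)
    thus "\<kappa> w \<in> \<kappa> ` F" using w \<kappa> F by auto
  qed
  hence "card W = (\<Sum>c\<in>\<kappa> ` F. card {w\<in>W. \<kappa> w = c})"
    using sum.group[of W "\<kappa> ` F" \<kappa> "\<lambda>_. 1::nat"] finW F by simp
  moreover have "2 ^ n * card F = (\<Sum>c\<in>\<kappa> ` F. 2 ^ n * card {f\<in>F. \<kappa> f = c})"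
    using card_eq_sum_fibres[OF F(1), of \<kappa>] by (simp add: sum_distrib_left)
  moreover have "\<dots> \<le> (\<Sum>c\<in>\<kappa> ` F. card {w\<in>W. \<kappa> w = c})"
    using coset by (intro sum_mono) auto
  ultimately show ?thesis using W_le by (simp add: T_def)
qed simp

text \<open>The cube in the preceding estimate is absorbed by the Folner property: the set \<open>F'\<close> of those
points of \<open>F i\<close> that every element of the cube \<open>Q\<close> keeps inside \<open>F i\<close> has almost full size, and
the products \<open>f\<^sup>-\<^sup>1 q f'\<close> with \<open>f, f' \<in> F'\<close> and \<open>q \<in> Q\<close> all lie in the difference set of \<open>F i\<close>.\<close>

lemma tempelman_constant_ge:
  assumes folner: "folner_sequence G F" and const: "tempelman_constant G F C"
  shows "2 ^ n \<le> C"
proof -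
  let ?Q = "int_box n 0 2"
  define \<rho> where "\<rho> q i = card (l_coset G (\<psi> q) (F i) \<inter> F i) / card (F i)" for q i
  have Q: "\<psi> q \<in> carrier G" if "q \<in> ?Q" for q
    using that int_box_subset emb_closed by blast
  have F: "F i \<subseteq> carrier G" "finite (F i)" "F i \<noteq> {}" for i
    using folner by (auto simp: folner_sequence_def)
  have "2 ^ n * (1 - (\<Sum>q\<in>?Q. 1 - \<rho> q i)) \<le> C" for i
  proof -
    define F' where "F' = {f\<in>F i. \<forall>q\<in>?Q. \<psi> q \<otimes> f \<in> F i}"
    have F': "F' \<subseteq> F i" "finite F'" using F(2) by (auto simp: F'_def)
    have pos: "0 < card (F i)" using F by (simp add: card_gt_0_iff)
    have compl: "real (card {f\<in>F i. \<psi> q \<otimes> f \<notin> F i}) = card (F i) * (1 - \<rho> q i)" if "q \<in> ?Q" for q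
    proof -
      have "{f\<in>F i. \<psi> q \<otimes> f \<notin> F i} = F i - {f\<in>F i. \<psi> q \<otimes> f \<in> F i}" by auto
      hence "card {f\<in>F i. \<psi> q \<otimes> f \<notin> F i} = card (F i) - card (l_coset G (\<psi> q) (F i) \<inter> F i)"
        using F by (simp add: card_translate_Int[OF Q[OF that] F(1)] card_Diff_subset)
      moreover have "card (l_coset G (\<psi> q) (F i) \<inter> F i) \<le> card (F i)"
        using F by (intro card_mono) auto
      ultimately show ?thesis using pos by (simp add: \<rho>_def field_simps)
    qed
    have "F i - F' = (\<Union>q\<in>?Q. {f\<in>F i. \<psi> q \<otimes> f \<notin> F i})" by (auto simp: F'_def)
    hence "card (F i - F') \<le> (\<Sum>q\<in>?Q. card {f\<in>F i. \<psi> q \<otimes> f \<notin> F i})"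
      using card_UN_le[OF finite_int_box] by simp
    hence "real (card (F i - F')) \<le> (\<Sum>q\<in>?Q. real (card {f\<in>F i. \<psi> q \<otimes> f \<notin> F i}))"
      by (simp flip: of_nat_sum)
    also have "\<dots> = card (F i) * (\<Sum>q\<in>?Q. 1 - \<rho> q i)"
      using compl by (simp add: sum_distrib_left)
    finally have "card (F i) * (1 - (\<Sum>q\<in>?Q. 1 - \<rho> q i)) \<le> card F'"
      using F' F(2)[of i] card_mono[OF F(2) F'(1)]
      by (simp add: card_Diff_subset algebra_simps)
    hence "2 ^ n * (card (F i) * (1 - (\<Sum>q\<in>?Q. 1 - \<rho> q i))) \<le> 2 ^ n * card F'"
      by simp
    also have "\<dots> \<le> card (set_inv F' <#> (\<psi> ` ?Q <#> F'))"
      using of_nat_mono[OF card_diff_cube_ge[of F'], where 'a = real] F' F(1)[of i] by auto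
    also have "\<dots> \<le> card (set_inv (F i) <#> F i)"
    proof -
      have "set_inv (F i) <#> F i = (\<lambda>(f, y). inv f \<otimes> y) ` (F i \<times> F i)"
        by (force simp: SET_INV_def set_mult_def)
      hence "finite (set_inv (F i) <#> F i)" using F by simp
      moreover have "set_inv F' <#> (\<psi> ` ?Q <#> F') \<subseteq> set_inv (F i) <#> F i"
        by (auto simp: SET_INV_def set_mult_def F'_def)
      ultimately show ?thesis by (simp add: card_mono)
    qed
    also have "\<dots> \<le> C * card (F i)"
      using const by (simp add: tempelman_constant_def)
    finally have "2 ^ n * (1 - (\<Sum>q\<in>?Q. 1 - \<rho> q i)) * card (F i) \<le> C * card (F i)"
      by (simp only: mult_ac)
    thus ?thesis using pos by simp
  qed
  moreover have "\<rho> q \<longlonglongrightarrow> 1" if "q \<in> ?Q" for q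
    using folner Q[OF that] by (simp add: folner_sequence_def \<rho>_def[abs_def])
  hence "(\<lambda>i. 2 ^ n * (1 - (\<Sum>q\<in>?Q. 1 - \<rho> q i))) \<longlonglongrightarrow> 2 ^ n * (1 - (\<Sum>q\<in>?Q. 1 - 1))"
    by (intro tendsto_intros)
  ultimately have "2 ^ n * (1 - (\<Sum>q\<in>?Q. 1 - 1 :: real)) \<le> C"
    by (intro LIMSEQ_le_const2) auto
  thus ?thesis by simp
qed

end

section \<open>Torsion modulo a lattice of maximal rank\<close>

text \<open>An element with no positive power in the lattice spans a new independent direction. This is
how maximality of the rank forces the quotient by the lattice to be torsion.\<close>

lemma (in comm_group) embedded_lattice_extend:
  assumes "embedded_lattice G n \<psi>" and g: "g \<in> carrier G"
    and free: "\<And>m::nat. 0 < m \<Longrightarrow> g [^] m \<notin> \<psi> ` int_lattice n"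
  shows "embedded_lattice G (Suc n) (\<lambda>z. \<psi> (z(n := 0)) \<otimes> g [^] z n)"
proof -
  interpret embedded_lattice G n \<psi> by fact
  have trunc: "z(n := 0) \<in> int_lattice n" if "z \<in> int_lattice (Suc n)" for z
    using that by (auto simp: int_lattice_def)
  show ?thesis
  proof (rule embedded_latticeI)
    fix z assume z: "z \<in> int_lattice (Suc n)"
    show "\<psi> (z(n := 0)) \<otimes> g [^] z n \<in> carrier G"
      using emb_closed trunc[OF z] g by simp
    assume eq: "\<psi> (z(n := 0)) \<otimes> g [^] z n = \<one>"
    have "g [^] z n \<in> L" "g [^] (- z n) \<in> L"
    proof -
      have "g [^] (- z n) = \<psi> (z(n := 0))"
        using inv_equality[OF eq] emb_closed trunc[OF z] g by (simp add: int_pow_neg)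
      thus *: "g [^] (- z n) \<in> L" using trunc[OF z] by simp
      show "g [^] z n \<in> L"
        using subgroup.m_inv_closed[OF subgroup_L *] g by (simp add: int_pow_neg)
    qed
    hence "g [^] nat \<bar>z n\<bar> \<in> L"
      by (metis abs_ge_zero abs_if int_pow_int nat_0_le)
    hence "z n = 0" using free[of "nat \<bar>z n\<bar>"] by fastforce
    moreover from this have "z(n := 0) = z" by (metis fun_upd_triv)
    ultimately have "\<psi> z = \<one>" "z \<in> int_lattice n"
      using eq trunc[OF z] emb_closed by auto
    thus "z = 0"
      using emb_inj emb_zero int_lattice_closed(1) by (metis inj_onD)
  next
    fix z w assume z: "z \<in> int_lattice (Suc n)" and w: "w \<in> int_lattice (Suc n)"
    have "(z + w)(n := 0) = z(n := 0) + w(n := 0)" by (auto simp: fun_eq_iff)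
    thus "\<psi> ((z + w)(n := 0)) \<otimes> g [^] (z + w) n =
        \<psi> (z(n := 0)) \<otimes> g [^] z n \<otimes> (\<psi> (w(n := 0)) \<otimes> g [^] w n)"
      using trunc[OF z] trunc[OF w] g emb_closed
      by (simp add: emb_add int_pow_mult m_ac)
  qed
qed

text \<open>A torsion quotient is locally finite because the group is abelian: adjoining one more element
\<open>k\<close> with \<open>k\<^sup>p \<in> E\<close> multiplies the number of coset representatives by at most \<open>p\<close>.\<close>

lemma (in comm_group) finite_index_overgroup_of_torsion:
  assumes E: "subgroup E G" and "finite K" "K \<subseteq> carrier G"
    and tors: "\<And>g. g \<in> carrier G \<Longrightarrow> \<exists>p::nat. 0 < p \<and> g [^] p \<in> E"
  shows "\<exists>D S. subgroup D G \<and> E \<subseteq> D \<and> K \<subseteq> D \<and> finite S \<and> S \<subseteq> carrier G \<and> D \<subseteq> S <#> E"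
  using assms(2,3)
proof (induction K rule: finite_induct)
  case empty
  have "{\<one>} <#> E = E" using subgroup.subset[OF E] by (force simp: set_mult_def)
  thus ?case using E by (intro exI[of _ E] exI[of _ "{\<one>}"]) auto
next
  case (insert k K)
  then obtain D S where D: "subgroup D G" "E \<subseteq> D" "K \<subseteq> D" "finite S" "S \<subseteq> carrier G" "D \<subseteq> S <#> E"
    by auto
  have k: "k \<in> carrier G" using insert.prems by simp
  obtain p :: nat where p: "0 < p" "k [^] p \<in> E" using tors[OF k] by blast
  define D' where "D' = generate G {k} <#> D"
  define S' where "S' = (\<lambda>(i::nat, s). k [^] i \<otimes> s) ` ({..<p} \<times> S)"
  have gen: "subgroup (generate G {k}) G" using k by (intro generate_is_subgroup) auto
  have sub: "subgroup D' G" unfolding D'_def by (rule mult_subgroups[OF gen D(1)])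
  have "D \<subseteq> D'"
  proof
    fix d assume d: "d \<in> D"
    have "\<one> \<otimes> d \<in> D'" unfolding D'_def set_mult_def
      using d subgroup.one_closed[OF gen] by blast
    thus "d \<in> D'" using d subgroup.subset[OF D(1)] by auto
  qed
  moreover have "k \<in> D'"
  proof -
    have "k \<otimes> \<one> \<in> D'" unfolding D'_def set_mult_def
      using generate.incl[of k "{k}" G] subgroup.one_closed[OF D(1)] by blast
    thus ?thesis using k by simp
  qed
  moreover have "finite S'" using D(4) by (simp add: S'_def)
  moreover have "S' \<subseteq> carrier G" using D(5) k by (auto simp: S'_def)
  moreover have "D' \<subseteq> S' <#> E"
  proof
    fix x assume "x \<in> D'"
    then obtain j :: int and d where x: "x = k [^] j \<otimes> d" "d \<in> D"
      unfolding D'_def generate_pow[OF k] by (auto simp: set_mult_def)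
    have "d \<in> S <#> E" using x D by auto
    then obtain s e where d: "d = s \<otimes> e" "s \<in> S" "e \<in> E" by (auto simp: set_mult_def)
    define i where "i = nat (j mod int p)"
    define e' where "e' = (k [^] p) [^] (j div int p)"
    have i: "i < p" "int i = j mod int p" using p by (auto simp: i_def nat_less_iff)
    have e': "e' \<in> E" unfolding e'_def by (rule subgroup_int_pow_closed[OF E p(2)])
    have "k [^] j = k [^] (int p * (j div int p) + int i)" using i by simp
    also have "\<dots> = e' \<otimes> k [^] i"
      using k by (simp only: int_pow_mult e'_def int_pow_int int_pow_pow[symmetric])
    finally have "x = (k [^] i \<otimes> s) \<otimes> (e' \<otimes> e)"
      using x d e' k D(5) subgroup.subset[OF E] by (simp add: m_ac subset_iff)
    moreover have "k [^] i \<otimes> s \<in> S'" using i d by (auto simp: S'_def)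
    moreover have "e' \<otimes> e \<in> E" using e' d subgroup.m_closed[OF E] by simp
    ultimately show "x \<in> S' <#> E" unfolding set_mult_def by blast
  qed
  ultimately show ?case using sub D by (intro exI[of _ D'] exI[of _ S']) auto
qed

lemma (in comm_group) finite_index_imp_common_exponent:
  assumes E: "subgroup E G" and S: "finite S" "S \<subseteq> carrier G"
    and tors: "\<And>g. g \<in> carrier G \<Longrightarrow> \<exists>p::nat. 0 < p \<and> g [^] p \<in> E"
  shows "\<exists>m::nat. 0 < m \<and> (\<forall>d \<in> S <#> E. d [^] m \<in> E)"
proof -
  have pow_E: "e [^] k \<in> E" if "e \<in> E" for e and k :: nat
    using subgroup_int_pow_closed[OF E that, of "int k"] by (simp add: int_pow_int)
  obtain p :: "'a \<Rightarrow> nat" where p: "\<And>s. s \<in> carrier G \<Longrightarrow> 0 < p s \<and> s [^] p s \<in> E"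
    using tors by metis
  define m where "m = (\<Prod>s\<in>S. p s)"
  have "d [^] m \<in> E" if "d \<in> S <#> E" for d
  proof -
    obtain s e where d: "d = s \<otimes> e" "s \<in> S" "e \<in> E" using \<open>d \<in> S <#> E\<close> by (auto simp: set_mult_def)
    have s: "s \<in> carrier G" and e: "e \<in> carrier G" using d S subgroup.subset[OF E] by auto
    have "p s dvd m" unfolding m_def using S(1) d(2) by (rule dvd_prodI)
    then obtain q where "m = p s * q" by (rule dvdE)
    hence "s [^] m = (s [^] p s) [^] q" using s by (simp add: nat_pow_pow)
    hence "s [^] m \<in> E" using p[OF s] pow_E by simp
    moreover have "d [^] m = s [^] m \<otimes> e [^] m" using d s e by (simp add: nat_pow_distrib)
    ultimately show ?thesis using pow_E[OF d(3)] subgroup.m_closed[OF E] by simp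
  qed
  moreover have "0 < m" unfolding m_def using p S(2) by (intro prod_pos) auto
  ultimately show ?thesis by blast
qed

section \<open>Half-open boxes in a finite extension of a lattice\<close>

text \<open>Here \<open>S\<close> bounds the index of the lattice in \<open>D\<close>, and \<open>m\<close> is a common exponent of the quotient.\<close>

locale finite_index_overgroup = embedded_lattice G n \<psi> + comm_group G
  for G :: "('a, 'b) monoid_scheme" (structure) and n \<psi> +
  fixes D S :: "'a set" and m :: nat
  assumes subgroup_D: "subgroup D G" and L_le_D: "\<psi> ` int_lattice n \<subseteq> D"
    and S: "finite S" "S \<subseteq> carrier G" "D \<subseteq> S <#> \<psi> ` int_lattice n"
    and m_pos: "0 < m" and D_pow: "d \<in> D \<Longrightarrow> d [^] m \<in> \<psi> ` int_lattice n"
begin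

text \<open>The lattice coordinates of \<open>g\<^sup>m\<close>, that is, \<open>m\<close> times the rational coordinates of \<open>g\<close>. The
homomorphism so obtained has the torsion of \<open>D\<close> as kernel, and no splitting of \<open>D\<close> into a free and
a finite part has to be chosen.\<close>

definition coord :: "'a \<Rightarrow> nat \<Rightarrow> int" where
  "coord g = inv_into (int_lattice n) \<psi> (g [^] m)"

lemma D_carrier: "g \<in> D \<Longrightarrow> g \<in> carrier G"
  using subgroup.subset[OF subgroup_D] by blast

lemma coord_mem: "g \<in> D \<Longrightarrow> coord g \<in> int_lattice n"
  unfolding coord_def by (rule inv_into_into[OF D_pow])

lemma coord_eqI: "z \<in> int_lattice n \<Longrightarrow> \<psi> z = g [^] m \<Longrightarrow> coord g = z"
  unfolding coord_def by (metis emb_inj inv_into_f_f)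

lemma emb_coord: "g \<in> D \<Longrightarrow> \<psi> (coord g) = g [^] m"
  unfolding coord_def by (rule f_inv_into_f[OF D_pow])

lemma coord_mult:
  assumes "g \<in> D" "h \<in> D"
  shows "coord (g \<otimes> h) = coord g + coord h"
  using assms coord_mem emb_coord D_carrier int_lattice_closed(2)
  by (intro coord_eqI) (auto simp: emb_add nat_pow_distrib)

lemma coord_one: "coord \<one> = 0"
  by (rule coord_eqI) (simp_all add: emb_zero int_lattice_closed)

lemma coord_inv:
  assumes "g \<in> D" shows "coord (inv g) = - coord g"
  using coord_mult[OF subgroup.m_inv_closed[OF subgroup_D assms] assms] D_carrier[OF assms] coord_one
  by (simp add: eq_neg_iff_add_eq_0)

lemma emb_pow: "z \<in> int_lattice n \<Longrightarrow> \<psi> z [^] k = \<psi> (\<lambda>i. int k * z i)" for k :: nat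
proof (induction k)
  case 0
  show ?case using emb_zero by (simp add: zero_fun_def)
next
  case (Suc k)
  have "(\<lambda>i. int (Suc k) * z i) = (\<lambda>i. int k * z i) + z"
    by (auto simp: fun_eq_iff algebra_simps)
  moreover have "(\<lambda>i. int k * z i) \<in> int_lattice n"
    using Suc.prems by (auto simp: int_lattice_def)
  ultimately show ?case using Suc by (simp add: emb_add)
qed

lemma coord_emb: "z \<in> int_lattice n \<Longrightarrow> coord (\<psi> z) = (\<lambda>i. int m * z i)"
  by (rule coord_eqI) (auto simp: emb_pow int_lattice_def)

text \<open>The elements of \<open>D\<close> whose rational coordinates lie in the half-open interval \<open>[a, b)\<close>. Half-open
boxes are tiled by lattice translates of the unit box, so doubling the side multiplies the size by
exactly \<open>2\<^sup>n\<close>, whatever the position of the remaining points of \<open>D\<close> relative to the lattice.\<close>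

definition coord_box :: "int \<Rightarrow> int \<Rightarrow> 'a set" where
  "coord_box a b = {g \<in> D. \<forall>k<n. int m * a \<le> coord g k \<and> coord g k < int m * b}"

text \<open>Two elements of the same lattice coset differ by a lattice vector, and a lattice vector by which
two points of the unit box differ is \<open>0\<close>; so the unit box has at most one point per coset.\<close>

lemma finite_unit_box: "finite (coord_box 0 1)"
proof -
  have "\<forall>g\<in>coord_box 0 1. \<exists>s. s \<in> S \<and> (\<exists>z\<in>int_lattice n. g = s \<otimes> \<psi> z)"
  proof
    fix g assume "g \<in> coord_box 0 1"
    hence "g \<in> S <#> L" using S(3) by (auto simp: coord_box_def)
    thus "\<exists>s. s \<in> S \<and> (\<exists>z\<in>int_lattice n. g = s \<otimes> \<psi> z)" by (auto simp: set_mult_def)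
  qed
  from bchoice[OF this] obtain s
    where s: "\<And>g. g \<in> coord_box 0 1 \<Longrightarrow> s g \<in> S \<and> (\<exists>z\<in>int_lattice n. g = s g \<otimes> \<psi> z)"
    by blast
  have "inj_on s (coord_box 0 1)"
  proof (rule inj_onI)
    fix g h assume gh: "g \<in> coord_box 0 1" "h \<in> coord_box 0 1" "s g = s h"
    obtain z w where zw: "z \<in> int_lattice n" "w \<in> int_lattice n"
      and "g = s g \<otimes> \<psi> z" "h = s h \<otimes> \<psi> w"
      using s[OF gh(1)] s[OF gh(2)] by blast
    then obtain t where t: "t \<in> carrier G" "g = t \<otimes> \<psi> z" "h = t \<otimes> \<psi> w"
      using s[OF gh(1)] S(2) gh(3) by (metis subsetD)
    define v where "v = w - z"
    have v: "v \<in> int_lattice n" using zw int_lattice_closed by (simp add: v_def)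
    have "\<psi> w = \<psi> z \<otimes> \<psi> v" using emb_add[OF zw(1) v] by (simp add: v_def)
    hence h: "h = g \<otimes> \<psi> v"
      using t zw v emb_closed by (simp add: m_assoc)
    have "coord h = coord g + coord (\<psi> v)"
      unfolding h using gh(1) v L_le_D by (intro coord_mult) (auto simp: coord_box_def)
    hence ch: "coord h k = coord g k + int m * v k" for k
      using v by (simp add: coord_emb)
    have "v k = 0" for k
    proof (cases "k < n")
      case True
      hence "0 \<le> coord g k \<and> coord g k < int m" "0 \<le> coord h k \<and> coord h k < int m"
        using gh(1,2) by (auto simp: coord_box_def)
      hence "\<bar>int m * v k\<bar> < int m * 1"
        using ch[of k] by linarith
      hence "\<bar>v k\<bar> < 1"
        using m_pos by (simp add: abs_mult)
      thus ?thesis by simp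
    next
      case False
      thus ?thesis using v by (auto simp: int_lattice_def)
    qed
    hence "v = 0" by (auto simp: fun_eq_iff)
    thus "g = h" using h emb_zero gh(1) D_carrier by (simp add: coord_box_def)
  qed
  moreover have "s ` coord_box 0 1 \<subseteq> S" using s by auto
  ultimately show ?thesis using S(1) by (rule inj_on_finite)
qed

text \<open>The lattice part of \<open>g\<close> is read off by rounding its rational coordinates down.\<close>

lemma box_decomp:
  "bij_betw (\<lambda>(z, g). \<psi> z \<otimes> g) (int_box n a b \<times> coord_box 0 1) (coord_box a b)"
proof -
  have coord_shift: "coord (\<psi> z \<otimes> g) = (\<lambda>k. int m * z k + coord g k)"
    if "z \<in> int_lattice n" "g \<in> D" for z g
    using that L_le_D by (subst coord_mult) (auto simp: coord_emb fun_eq_iff)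
  define fl where "fl g = (\<lambda>k. coord g k div int m)" for g
  have fl_mem: "fl g \<in> int_lattice n" if "g \<in> D" for g
    using coord_mem[OF that] by (auto simp: int_lattice_def fl_def)
  have fl_eq: "fl (\<psi> z \<otimes> g) = z" if "z \<in> int_lattice n" "g \<in> coord_box 0 1" for z g
  proof
    fix k
    have "coord g k div int m = 0"
      using that(2) coord_mem[of g] by (cases "k < n") (auto simp: coord_box_def int_lattice_def)
    thus "fl (\<psi> z \<otimes> g) k = z k"
      using that m_pos by (simp add: fl_def coord_shift coord_box_def)
  qed
  show ?thesis
  proof (rule bij_betw_byWitness[where f' = "\<lambda>g. (fl g, \<psi> (- fl g) \<otimes> g)"])
    show "\<forall>x\<in>int_box n a b \<times> coord_box 0 1.
            (\<lambda>g. (fl g, \<psi> (- fl g) \<otimes> g)) ((\<lambda>(z, g). \<psi> z \<otimes> g) x) = x"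
      using int_box_subset[of n a b] D_carrier emb_closed
      by (auto simp: fl_eq emb_minus coord_box_def subset_iff m_assoc[symmetric])
    show "\<forall>g\<in>coord_box a b. (\<lambda>(z, g). \<psi> z \<otimes> g) ((\<lambda>g. (fl g, \<psi> (- fl g) \<otimes> g)) g) = g"
      using fl_mem D_carrier emb_closed by (auto simp: emb_minus coord_box_def m_assoc[symmetric])
    show "(\<lambda>(z, g). \<psi> z \<otimes> g) ` (int_box n a b \<times> coord_box 0 1) \<subseteq> coord_box a b"
    proof (clarsimp)
      fix z g assume z: "z \<in> int_box n a b" and g: "g \<in> coord_box 0 1"
      have "\<psi> z \<otimes> g \<in> D"
        using z g int_box_subset[of n a b] L_le_D subgroup.m_closed[OF subgroup_D]
        by (auto simp: coord_box_def subset_iff)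
      moreover have "int m * a \<le> int m * z k + coord g k \<and> int m * z k + coord g k < int m * b"
        if "k < n" for k
      proof -
        have "a \<le> z k" "z k + 1 \<le> b" using z that by (auto simp: int_box_def)
        hence "int m * a \<le> int m * z k" "int m * (z k + 1) \<le> int m * b"
          by (intro mult_left_mono; simp)+
        moreover have "0 \<le> coord g k" "coord g k < int m" using g that by (auto simp: coord_box_def)
        moreover have "int m * (z k + 1) = int m * z k + int m" by (simp add: distrib_left)
        ultimately show ?thesis by linarith
      qed
      ultimately show "\<psi> z \<otimes> g \<in> coord_box a b"
        using z g coord_shift[of z g] int_box_subset[of n a b] by (auto simp: coord_box_def)
    qed
    show "(\<lambda>g. (fl g, \<psi> (- fl g) \<otimes> g)) ` coord_box a b \<subseteq> int_box n a b \<times> coord_box 0 1"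
    proof (clarsimp, intro conjI)
      fix g assume g: "g \<in> coord_box a b"
      have gD: "g \<in> D" using g by (simp add: coord_box_def)
      show "fl g \<in> int_box n a b"
      proof -
        have "a \<le> coord g k div int m \<and> coord g k div int m < b" if "k < n" for k
        proof
          have c: "int m * a \<le> coord g k" "coord g k < int m * b"
            using g that by (auto simp: coord_box_def)
          show "a \<le> coord g k div int m"
            using zdiv_mono1[OF c(1), of "int m"] m_pos by simp
          have "int m * (coord g k div int m) + coord g k mod int m = coord g k"
            by (rule mult_div_mod_eq)
          moreover have "0 \<le> coord g k mod int m" using m_pos by simp
          ultimately have "int m * (coord g k div int m) < int m * b" using c(2) by linarith
          thus "coord g k div int m < b" using m_pos by simp
        qed
        thus ?thesis using fl_mem[OF gD] by (auto simp: int_box_def fl_def)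
      qed
      have "- fl g \<in> int_lattice n" using fl_mem[OF gD] int_lattice_closed by blast
      moreover from this have "\<psi> (- fl g) \<otimes> g \<in> D"
        using L_le_D gD subgroup.m_closed[OF subgroup_D] by auto
      moreover have "0 \<le> int m * - fl g k + coord g k \<and> int m * - fl g k + coord g k < int m" for k
        using m_pos by (simp add: fl_def minus_mult_div_eq_mod)
      ultimately show "\<psi> (- fl g) \<otimes> g \<in> coord_box 0 1"
        using gD by (auto simp: coord_box_def coord_shift)
    qed
  qed
qed

lemma finite_box: "finite (coord_box a b)"
  using bij_betw_finite[OF box_decomp[of a b]] finite_unit_box finite_int_box by simp

lemma card_box: "card (coord_box a b) = nat (b - a) ^ n * card (coord_box 0 1)"
  using bij_betw_same_card[OF box_decomp[of a b]] by (simp add: card_cartesian_product card_int_box)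

text \<open>Differences of points of the box lie in an open box of twice the side; enlarging it to a half-open
one gives a box whose size is known exactly.\<close>

lemma box_diff_subset: "set_inv (coord_box (- M) M) <#> coord_box (- M) M \<subseteq> coord_box (- 2 * M) (2 * M)"
proof
  fix x assume "x \<in> set_inv (coord_box (- M) M) <#> coord_box (- M) M"
  then obtain f g where fg: "x = inv f \<otimes> g" "f \<in> coord_box (- M) M" "g \<in> coord_box (- M) M"
    by (auto simp: SET_INV_def set_mult_def)
  hence D: "f \<in> D" "g \<in> D" "inv f \<in> D"
    using subgroup.m_inv_closed[OF subgroup_D] by (auto simp: coord_box_def)
  have "coord x = coord g - coord f"
    using D by (simp add: fg coord_mult coord_inv)
  moreover have "x \<in> D" using D subgroup.m_closed[OF subgroup_D] fg by simp
  ultimately show "x \<in> coord_box (- 2 * M) (2 * M)"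
    using fg by (fastforce simp: coord_box_def)
qed

lemma card_box_diff: "card (set_inv (coord_box (- M) M) <#> coord_box (- M) M) \<le> 2 ^ n * card (coord_box (- M) M)"
proof -
  have "nat (4 * M) = 2 * nat (2 * M)" by (cases "M \<ge> 0") auto
  hence "card (coord_box (- 2 * M) (2 * M)) = 2 ^ n * card (coord_box (- M) M)"
    unfolding card_box[of "- 2 * M"] card_box[of "- M"] by (simp add: power_mult_distrib)
  thus ?thesis
    using card_mono[OF finite_box box_diff_subset[of M]] by simp
qed

lemma box_translate:
  assumes "g \<in> D" "\<And>k. k < n \<Longrightarrow> \<bar>coord g k\<bar> \<le> int m * c" "f \<in> coord_box (- (M - c)) (M - c)"
  shows "g \<otimes> f \<in> coord_box (- M) M"
proof -
  have f: "f \<in> D" using assms(3) by (simp add: coord_box_def)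
  have "- (int m * M) \<le> coord g k + coord f k \<and> coord g k + coord f k < int m * M" if "k < n" for k
    using assms(2)[OF that] assms(3) that by (force simp: coord_box_def algebra_simps)
  thus ?thesis
    using f assms(1) subgroup.m_closed[OF subgroup_D] by (simp add: coord_box_def coord_mult)
qed

lemma box_mono: "b \<le> b' \<Longrightarrow> a' \<le> a \<Longrightarrow> coord_box a b \<subseteq> coord_box a' b'"
proof -
  assume "b \<le> b'" "a' \<le> a"
  hence "int m * b \<le> int m * b'" "int m * a' \<le> int m * a"
    by (intro mult_left_mono; simp)+
  thus ?thesis by (force simp: coord_box_def)
qed

text \<open>With \<open>c\<close> a bound for the coordinates of \<open>K\<close>, the box of radius \<open>M\<close> contains \<open>K\<close>, and each
\<open>g \<in> K\<close> moves the concentric box of radius \<open>M - c\<close> into it. The ratio of the sizes is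
\<open>(1 - c / M)\<^sup>n\<close>, which tends to \<open>1\<close>.\<close>

lemma ex_almost_invariant_box:
  fixes \<epsilon> :: real
  assumes "finite K" "K \<subseteq> D" "0 < \<epsilon>"
  shows "\<exists>M. K \<subseteq> coord_box (- M) M \<and>
    (\<forall>g\<in>K. (1 - \<epsilon>) * card (coord_box (- M) M) \<le> card (l_coset G g (coord_box (- M) M) \<inter> coord_box (- M) M))"
proof -
  define c where "c = Max (insert 1 ((\<lambda>(g, k). \<bar>coord g k\<bar> + 1) ` (K \<times> {..<n})))"
  have c1: "1 \<le> c" unfolding c_def using assms(1) by (intro Max_ge) auto
  have c: "\<bar>coord g k\<bar> < int m * c" if "g \<in> K" "k < n" for g k
  proof -
    have "\<bar>coord g k\<bar> + 1 \<le> c"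
      unfolding c_def using assms(1) that by (intro Max_ge) auto
    also have "c \<le> int m * c" using c1 m_pos by (simp add: mult_le_cancel_right1)
    finally show ?thesis by simp
  qed
  have "(\<lambda>M::nat. 1 - real_of_int c / real M) \<longlonglongrightarrow> 1 - 0"
    by (intro tendsto_diff tendsto_const lim_const_over_n)
  hence "(\<lambda>M::nat. (1 - real_of_int c / real M) ^ n) \<longlonglongrightarrow> 1 ^ n"
    by (intro tendsto_power) simp
  hence "\<forall>\<^sub>F M in sequentially. (1 - real_of_int c / real M) ^ n > 1 - \<epsilon>"
    using assms(3) by (intro order_tendstoD) auto
  hence "\<forall>\<^sub>F M in sequentially. (1 - real_of_int c / real M) ^ n > 1 - \<epsilon> \<and> nat c < M"
    using eventually_gt_at_top[of "nat c"] by eventually_elim simp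
  then obtain M0 where M0: "(1 - real_of_int c / real M0) ^ n > 1 - \<epsilon>" "nat c < M0"
    by (auto simp: eventually_sequentially)
  define M where "M = int M0"
  have M: "c < M" "0 < M" "real M0 = real_of_int M" using M0(2) c1 by (auto simp: M_def)
  have cM: "int m * c \<le> int m * M" using M by (intro mult_left_mono) auto
  have "K \<subseteq> coord_box (- M) M"
    using assms(2) c cM by (fastforce simp: coord_box_def)
  moreover have "(1 - \<epsilon>) * card (coord_box (- M) M) \<le> card (l_coset G g (coord_box (- M) M) \<inter> coord_box (- M) M)"
    if g: "g \<in> K" for g
  proof -
    have "(1 - \<epsilon>) * card (coord_box (- M) M) \<le> (1 - real_of_int c / M) ^ n * card (coord_box (- M) M)"
      using M0(1) M by (intro mult_right_mono) auto
    also have "\<dots> = ((1 - real_of_int c / M) * real_of_int (2 * M)) ^ n * card (coord_box 0 1)"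
      using M by (simp add: card_box[of "- M"] power_mult_distrib)
    also have "(1 - real_of_int c / M) * real_of_int (2 * M) = real_of_int (2 * (M - c))"
      using M by (simp add: field_simps)
    also have "\<dots> ^ n * card (coord_box 0 1) = card (coord_box (- (M - c)) (M - c))"
      unfolding card_box[of "- (M - c)"] using M by simp
    also have "\<dots> \<le> card {f \<in> coord_box (- M) M. g \<otimes> f \<in> coord_box (- M) M}"
    proof -
      have "coord_box (- (M - c)) (M - c) \<subseteq> {f \<in> coord_box (- M) M. g \<otimes> f \<in> coord_box (- M) M}"
        using box_translate[of g c _ M] g assms(2) c box_mono[of "M - c" M "- M" "- (M - c)"] c1
        by (force simp: less_imp_le)
      thus ?thesis using finite_box by (simp add: card_mono)
    qed
    also have "\<dots> = card (l_coset G g (coord_box (- M) M) \<inter> coord_box (- M) M)"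
      using g assms(2) D_carrier by (subst card_translate_Int) (auto simp: coord_box_def)
    finally show ?thesis .
  qed
  ultimately show ?thesis using M by blast
qed

end

section \<open>Tempel'man sequences in abelian groups\<close>

lemma (in comm_group) ex_almost_invariant_small_doubling:
  fixes \<epsilon> :: real
  assumes rank: "abelian_rank G = enat r" and K: "finite K" "K \<subseteq> carrier G" and \<epsilon>: "0 < \<epsilon>"
  shows "\<exists>F. finite F \<and> F \<noteq> {} \<and> F \<subseteq> carrier G \<and> K \<subseteq> F \<and>
    card (set_inv F <#> F) \<le> 2 ^ r * card F \<and>
    (\<forall>g\<in>K. (1 - \<epsilon>) * card F \<le> card (l_coset G g F \<inter> F))"
proof -
  obtain \<psi> where emb: "embedded_lattice G r \<psi>"
    using embedded_lattice_iff_le_abelian_rank[of r] rank by auto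
  interpret embedded_lattice G r \<psi> by fact
  have tors: "\<exists>p::nat. 0 < p \<and> g [^] p \<in> L" if g: "g \<in> carrier G" for g
  proof (rule ccontr)
    assume "\<not> ?thesis"
    hence "g [^] p \<notin> L" if "0 < p" for p :: nat using that by blast
    from embedded_lattice_extend[OF emb g this]
    have "embedded_lattice G (Suc r) (\<lambda>z. \<psi> (z(r := 0)) \<otimes> g [^] z r)" .
    hence "enat (Suc r) \<le> abelian_rank G"
      using embedded_lattice_iff_le_abelian_rank by blast
    thus False using rank by simp
  qed
  \<comment> \<open>The neutral element is added to \<open>K\<close> so that the box containing it is nonempty.\<close>
  obtain D S where D: "subgroup D G" "L \<subseteq> D" "insert \<one> K \<subseteq> D"
    and S: "finite S" "S \<subseteq> carrier G" "D \<subseteq> S <#> L"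
    using finite_index_overgroup_of_torsion[OF subgroup_L _ _ tors, of "insert \<one> K"] K by auto
  obtain m :: nat where m: "0 < m" "\<forall>d \<in> S <#> L. d [^] m \<in> L"
    using finite_index_imp_common_exponent[OF subgroup_L S(1,2) tors] by blast
  have pow: "d [^] m \<in> L" if "d \<in> D" for d using m(2) S(3) that by blast
  interpret finite_index_overgroup G r \<psi> D S m
    by (intro finite_index_overgroup.intro finite_index_overgroup_axioms.intro
        emb comm_group_axioms D(1,2) S m(1) pow)
  have "finite (insert \<one> K)" using K by simp
  from ex_almost_invariant_box[OF this D(3) \<epsilon>] obtain M where M: "insert \<one> K \<subseteq> coord_box (- M) M"
    "\<forall>g\<in>insert \<one> K. (1 - \<epsilon>) * card (coord_box (- M) M) \<le> card (l_coset G g (coord_box (- M) M) \<inter> coord_box (- M) M)"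
    by blast
  have "coord_box (- M) M \<subseteq> carrier G" using D_carrier by (auto simp: coord_box_def)
  thus ?thesis
    using M card_box_diff[of M] finite_box by (intro exI[of _ "coord_box (- M) M"]) auto
qed

text \<open>Each set is chosen to contain its predecessor and the next group element in an enumeration, and
to be almost invariant under the whole predecessor. An element enters the sequence when it is
enumerated and stays, so from then on the sets are more and more invariant under it.\<close>

lemma (in comm_group) ex_tempelman_sequence:
  assumes rank: "abelian_rank G = enat r" and count: "countable (carrier G)"
  shows "\<exists>F. tempelman_sequence G F \<and> tempelman_constant G F (2 ^ r)"
proof -
  define e where "e = from_nat_into (carrier G)"
  have e: "e i \<in> carrier G" for i
    unfolding e_def using one_closed by (intro from_nat_into) auto
  have e_surj: "\<exists>i. g = e i" if "g \<in> carrier G" for g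
    using from_nat_into_surj[OF count that] by (auto simp: e_def)
  define good where "good F \<longleftrightarrow> finite F \<and> F \<noteq> {} \<and> F \<subseteq> carrier G \<and> card (set_inv F <#> F) \<le> 2 ^ r * card F"
    for F
  define step where "step i A B \<longleftrightarrow> insert (e (Suc i)) A \<subseteq> B \<and>
      (\<forall>g\<in>A. (1 - 1 / real (Suc i)) * card B \<le> card (l_coset G g B \<inter> B))" for i A B
  have "\<exists>F. \<forall>i. (good (F i) \<and> e i \<in> F i) \<and> step i (F i) (F (Suc i))"
  proof (rule dependent_nat_choice)
    show "\<exists>A. good A \<and> e 0 \<in> A"
      using ex_almost_invariant_small_doubling[OF rank, of "{e 0}" 1] e by (auto simp: good_def)
  next
    fix A i assume "good A \<and> e i \<in> A"
    thus "\<exists>B. (good B \<and> e (Suc i) \<in> B) \<and> step i A B"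
      using ex_almost_invariant_small_doubling[OF rank, of "insert (e (Suc i)) A" "1 / real (Suc i)"] e
      by (auto simp: good_def step_def)
  qed
  then obtain F where F: "\<And>i. good (F i)" "\<And>i. e i \<in> F i" "\<And>i. step i (F i) (F (Suc i))"
    by blast
  have incr: "F i \<subseteq> F (Suc i)" for i using F(3)[of i] by (auto simp: step_def)
  have "folner_sequence G F"
    unfolding folner_sequence_def
  proof (intro conjI allI ballI)
    fix g assume "g \<in> carrier G"
    then obtain i0 where i0: "g = e i0" using e_surj by blast
    let ?\<rho> = "\<lambda>i. card (l_coset G g (F i) \<inter> F i) / card (F i)"
    have lower: "1 - 1 / real (Suc i) \<le> ?\<rho> (Suc i)" if "i0 \<le> i" for i
    proof -
      have "g \<in> F i" using F(2)[of i0] lift_Suc_mono_le[of F, OF incr that] i0 by blast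
      hence "(1 - 1 / real (Suc i)) * card (F (Suc i)) \<le> card (l_coset G g (F (Suc i)) \<inter> F (Suc i))"
        using F(3)[of i] by (simp add: step_def)
      moreover have "0 < card (F (Suc i))" using F(1)[of "Suc i"] by (simp add: good_def card_gt_0_iff)
      ultimately show ?thesis by (simp add: pos_le_divide_eq)
    qed
    have upper: "?\<rho> i \<le> 1" for i
    proof -
      have "finite (F i)" using F(1)[of i] by (simp add: good_def)
      hence "card (l_coset G g (F i) \<inter> F i) \<le> card (F i)" by (intro card_mono) auto
      thus ?thesis by (cases "card (F i) = 0") simp_all
    qed
    have "(\<lambda>i. 1 / real (Suc i)) \<longlonglongrightarrow> 0"
      using LIMSEQ_inverse_real_of_nat by (simp add: inverse_eq_divide)
    from tendsto_diff[OF tendsto_const[of 1] this]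
    have lim: "(\<lambda>i. 1 - 1 / real (Suc i)) \<longlonglongrightarrow> 1" by simp
    have "(\<lambda>i. ?\<rho> (Suc i)) \<longlonglongrightarrow> 1"
    proof (rule real_tendsto_sandwich[OF _ _ lim tendsto_const])
      show "\<forall>\<^sub>F i in sequentially. 1 - 1 / real (Suc i) \<le> ?\<rho> (Suc i)"
        using lower unfolding eventually_sequentially by blast
      show "\<forall>\<^sub>F i in sequentially. ?\<rho> (Suc i) \<le> 1"
        by (rule always_eventually) (rule allI, rule upper)
    qed
    thus "?\<rho> \<longlonglongrightarrow> 1" by (rule LIMSEQ_imp_Suc[of ?\<rho>])
  qed (use F(1) in \<open>auto simp: good_def\<close>)
  moreover have const: "tempelman_constant G F (2 ^ r)"
    unfolding tempelman_constant_def
  proof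
    fix i
    have "card (set_inv (F i) <#> F i) \<le> 2 ^ r * card (F i)" using F(1) by (simp add: good_def)
    from of_nat_mono[OF this, where 'a = real]
    show "real (card (set_inv (F i) <#> F i)) \<le> 2 ^ r * real (card (F i))" by simp
  qed
  ultimately show ?thesis
    unfolding tempelman_sequence_def using incr by blast
qed

lemma (in group) tempelman_constant_ge_of_rank:
  assumes "enat n \<le> abelian_rank G" "tempelman_sequence G F" "tempelman_constant G F C"
  shows "2 ^ n \<le> C"
proof -
  obtain \<psi> where "embedded_lattice G n \<psi>"
    using assms(1) embedded_lattice_iff_le_abelian_rank by blast
  thus ?thesis
    using assms embedded_lattice.tempelman_constant_ge by (auto simp: tempelman_sequence_def)
qed

theorem mainTheorem1:
  fixes G :: "('a, 'b) monoid_scheme"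
  assumes "group G" and "countable (carrier G)"
  shows "(\<forall>r::nat. abelian_rank G = enat r \<longrightarrow>
            (\<forall>F C. tempelman_sequence G F \<and> tempelman_constant G F C \<longrightarrow> C \<ge> 2 ^ r) \<and>
            (comm_group G \<longrightarrow>
               (\<exists>F. tempelman_sequence G F \<and> tempelman_constant G F (2 ^ r))))
       \<and> (abelian_rank G = \<infinity> \<longrightarrow> \<not> (\<exists>F. tempelman_sequence G F))"
proof (intro conjI allI impI)
  fix r F C
  assume "abelian_rank G = enat r" "tempelman_sequence G F \<and> tempelman_constant G F C"
  thus "2 ^ r \<le> C"
    using group.tempelman_constant_ge_of_rank[OF assms(1), of r F C] by simp
next
  fix r assume "abelian_rank G = enat r" "comm_group G"
  thus "\<exists>F. tempelman_sequence G F \<and> tempelman_constant G F (2 ^ r)"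
    using comm_group.ex_tempelman_sequence assms(2) by blast
next
  assume inf: "abelian_rank G = \<infinity>"
  show "\<not> (\<exists>F. tempelman_sequence G F)"
  proof
    assume "\<exists>F. tempelman_sequence G F"
    then obtain F C where F: "tempelman_sequence G F" "tempelman_constant G F C"
      by (auto simp: tempelman_sequence_def)
    obtain n where "C < 2 ^ n" using real_arch_pow[of 2 C] by auto
    moreover have "2 ^ n \<le> C"
      using group.tempelman_constant_ge_of_rank[OF assms(1) _ F] inf by simp
    ultimately show False by simp
  qed
qed

end
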